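(* Let $\sigma$ be a switch table for a subgroup $G$ of $\mathrm{Sym}(n)$ with maximal effective row $r$ and $c_i$ non-trivial switches in row $i$, $i=1,2,\dots,r$, such that $\gamma_1(m)=0$. (This is, e.g., the case whenever $G$ is transitive.) Denote by $r(j)$ the number of effective rows with index strictly larger than $j$. Define $\mu:=\frac{n-1}{n}$ and assume that $\rho_r(m)^2+\mu^2\le1$. Then the relative effort of $\sigma$ satisfies $$\mathrm{eff}_{\mathrm{mst}}(m)\le\Bigl(1+\sum_{j=1}^{r}\frac{1}{2^{r(j)}}\cdot\frac{c_j}{c_j+1}\Bigr)\rho_1(m)^2\le3\,\rho_1(m)^2 .$$
   Context: Throughout $1\le m<n$, $[n]=\{1,\dots,n\}$. Switch tables. For a subgroup $G\le\mathrm{Sym}(n)$ of order $k$, a switch table is a map $(i,j)\mapsto\sigma_{i,j}\in G$ on $[n]\times[n]$ such that for $j>i$, if some $g\in G$ has $g(j)=i$ and $g(t)=t$ for all $t<i$, then $\sigma_{i,j}$ is one such $g$; otherwise $\sigma_{i,j}=\mathrm{id}$. Non-identity entries are non-trivial; a row is effective if it has a non-trivial entry; $r$ is the largest index of an effective row; $J(i)$ is the set of columns of non-trivial entries in row $i$ and $c_i=|J(i)|$. One has $k=\prod_{j=1}^r(c_j+1)$. Parameters. For $0<\ell<n-i+1$: $\rho_i(\ell):=\frac{\ell}{n-i+1}$; for $\ell\le0$ or $\ell\ge n-i+1$: $\rho_i(\ell):=0$. With $(x)_\ell:=x(x-1)\cdots(x-\ell+1)$, the transitivity gap is $\gamma_i(\ell):=\frac{(n-i+1-(c_i+1))_\ell}{(n-i+1)_\ell}$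 for $0\le\ell\le n-i-c_i$ and $\gamma_i(\ell):=0$ for $\ell>n-i-c_i$. Modified switch-table method and cost. A call at level $i$ takes subsets $S,S'\subseteq\{i,\dots,n\}$ with $|S|=|S'|=\ell$; it is started at level $1$ with $\ell=m$. If $\ell=0$, or $i\le r$ and $\ell=n-i+1$, it returns at no cost. If $i=r+1$ and $\ell\ge1$, $S$ and $S'$ are compared lexicographically, counted as $\ell$ single-element evaluations. Otherwise: (element branch, $i\in S$) if $i\in S'$, make a call at level $i+1$ with $S\setminus\{i\},S'\setminus\{i\}$; and for each $j\in J(i)\cap S'$ compute $\sigma_{i,j}(S'\setminus\{j\})$ ($\ell-1$ evaluations) and make a call at level $i+1$ with $S\setminus\{i\}$ and this image; (non-element branch, $i\notin S$) if $i\in S'$ or $J(i)\cap S'\ne\emptyset$, return at no cost; otherwise make a call at level $i+1$ with $S,S'$, and for each $j\in J(i)$ compute $\sigma_{i,j}(S')$ ($\ell$ evaluations) and make a call at level $i+1$ with $S$ and this image. A negative answer of a recursive call does not stop the algorithm; all branches are carried out. Typical number $E_{\mathrm{mst}}(m)$: the expected total number of evaluations in the paper's simplified ("hyper-amortized") uniform model, in which in every call at level $i$ with cardinality $\ell$ the two subsets are regarded as independent and uniformly random $\ell$-subsets of $\{i,\dots,n\}$, disregarding their dependence on the subsets of earlier calls. Relative effort: $\mathrm{eff}_{\mathrm{mst}}(m):=E_{\mathrm{mst}}(m)/(km)$, where $km$ is the number of single-element evaluations of the naive method (apply each of the $k$ permutations to all $m$ elements). *)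

theory Defs
  imports "HOL-Probability.Probability_Mass_Function" "HOL-Algebra.Sym_Groups"
begin

text \<open>
  Permutations of \<open>[n] = {1..n}\<close> are functions on \<open>nat\<close> that fix everything outside \<open>{1..n}\<close>
  (as in \<^const>\<open>sym_group\<close>), and a switch table is a function \<open>\<sigma>\<close> of which only the
  values \<open>\<sigma> i j\<close> with \<open>i, j \<in> {1..n}\<close> matter.
\<close>

definition switch_candidate :: "(nat \<Rightarrow> nat) set \<Rightarrow> nat \<Rightarrow> nat \<Rightarrow> (nat \<Rightarrow> nat) \<Rightarrow> bool" where
  "switch_candidate G i j g \<longleftrightarrow> g \<in> G \<and> g j = i \<and> (\<forall>t\<in>{1..<i}. g t = t)"

definition is_switch_table ::
    "nat \<Rightarrow> (nat \<Rightarrow> nat) set \<Rightarrow> (nat \<Rightarrow> nat \<Rightarrow> nat \<Rightarrow> nat) \<Rightarrow> bool" where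
  "is_switch_table n G \<sigma> \<longleftrightarrow>
     (\<forall>i\<in>{1..n}. \<forall>j\<in>{1..n}.
        if i < j \<and> (\<exists>g. switch_candidate G i j g)
        then switch_candidate G i j (\<sigma> i j)
        else \<sigma> i j = id)"

definition nontriv_cols :: "nat \<Rightarrow> (nat \<Rightarrow> nat \<Rightarrow> nat \<Rightarrow> nat) \<Rightarrow> nat \<Rightarrow> nat set" where
  "nontriv_cols n \<sigma> i = {j \<in> {1..n}. \<sigma> i j \<noteq> id}"

definition num_switches :: "nat \<Rightarrow> (nat \<Rightarrow> nat \<Rightarrow> nat \<Rightarrow> nat) \<Rightarrow> nat \<Rightarrow> nat" where
  "num_switches n \<sigma> i = card (nontriv_cols n \<sigma> i)"

definition effective_rows :: "nat \<Rightarrow> (nat \<Rightarrow> nat \<Rightarrow> nat \<Rightarrow> nat) \<Rightarrow> nat set" where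
  "effective_rows n \<sigma> = {i \<in> {1..n}. nontriv_cols n \<sigma> i \<noteq> {}}"

text \<open>The value is \<open>0\<close> if there is no effective row, i.e. for the trivial group.\<close>

definition max_effective_row :: "nat \<Rightarrow> (nat \<Rightarrow> nat \<Rightarrow> nat \<Rightarrow> nat) \<Rightarrow> nat" where
  "max_effective_row n \<sigma> = Max (insert 0 (effective_rows n \<sigma>))"

definition effective_rows_above :: "nat \<Rightarrow> (nat \<Rightarrow> nat \<Rightarrow> nat \<Rightarrow> nat) \<Rightarrow> nat \<Rightarrow> nat" where
  "effective_rows_above n \<sigma> j = card {i \<in> effective_rows n \<sigma>. j < i}"

text \<open>
  Truncated subtraction is harmless below: the row index satisfies \<open>1 \<le> i \<le> n\<close>.
  Cardinalities are natural numbers, so the case \<open>l \<le> 0\<close> is \<open>l = 0\<close>.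
\<close>

definition subset_density :: "nat \<Rightarrow> nat \<Rightarrow> nat \<Rightarrow> real" where
  "subset_density n i l = (if 0 < l \<and> l < n - i + 1 then real l / real (n - i + 1) else 0)"

definition falling_fact :: "real \<Rightarrow> nat \<Rightarrow> real" where
  "falling_fact x l = (\<Prod>k<l. x - real k)"

definition transitivity_gap ::
    "nat \<Rightarrow> (nat \<Rightarrow> nat \<Rightarrow> nat \<Rightarrow> nat) \<Rightarrow> nat \<Rightarrow> nat \<Rightarrow> real" where
  "transitivity_gap n \<sigma> i l =
     (let c = num_switches n \<sigma> i; N = real n - real i + 1 in
      if int l \<le> int n - int i - int c
      then falling_fact (N - (real c + 1)) l / falling_fact N l
      else 0)"

text \<open>
  One branching step of the method at a level \<open>i \<le> r\<close>: the number of single-element evaluations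
  spent directly in the call, and the recursive calls (at level \<open>i + 1\<close>) it makes. The calls form
  a multiset since different switches may lead to the same image.
\<close>

definition step_evals ::
    "nat \<Rightarrow> (nat \<Rightarrow> nat \<Rightarrow> nat \<Rightarrow> nat) \<Rightarrow> nat \<Rightarrow> nat set \<Rightarrow> nat set \<Rightarrow> nat" where
  "step_evals n \<sigma> i S S' =
     (if i \<in> S then (\<Sum>j\<in>nontriv_cols n \<sigma> i \<inter> S'. card S - 1)
      else if i \<in> S' \<or> nontriv_cols n \<sigma> i \<inter> S' \<noteq> {} then 0
      else (\<Sum>j\<in>nontriv_cols n \<sigma> i. card S))"

definition step_calls ::
    "nat \<Rightarrow> (nat \<Rightarrow> nat \<Rightarrow> nat \<Rightarrow> nat) \<Rightarrow> nat \<Rightarrow> nat set \<Rightarrow> nat set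
       \<Rightarrow> (nat set \<times> nat set) multiset" where
  "step_calls n \<sigma> i S S' =
     (if i \<in> S then
        (if i \<in> S' then {#(S - {i}, S' - {i})#} else {#}) +
        image_mset (\<lambda>j. (S - {i}, \<sigma> i j ` (S' - {j}))) (mset_set (nontriv_cols n \<sigma> i \<inter> S'))
      else if i \<in> S' \<or> nontriv_cols n \<sigma> i \<inter> S' \<noteq> {} then {#}
      else
        {#(S, S')#} +
        image_mset (\<lambda>j. (S, \<sigma> i j ` S')) (mset_set (nontriv_cols n \<sigma> i)))"

definition uniform_subset :: "nat \<Rightarrow> nat \<Rightarrow> nat \<Rightarrow> nat set pmf" where
  "uniform_subset n i l = pmf_of_set {S. S \<subseteq> {i..n} \<and> card S = l}"

text \<open>
  Expected number of evaluations of a call at level \<open>i\<close> with cardinality \<open>l\<close>, including all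
  calls below it. In the uniform model every call sees a fresh pair of independent uniformly
  random \<open>l\<close>-subsets of \<open>{i..n}\<close>, so a recursive call contributes only through its level and
  cardinality. Levels beyond \<open>r + 1\<close> do not occur.
\<close>

function mst_cost ::
    "nat \<Rightarrow> (nat \<Rightarrow> nat \<Rightarrow> nat \<Rightarrow> nat) \<Rightarrow> nat \<Rightarrow> nat \<Rightarrow> real" where
  "mst_cost n \<sigma> i l =
     (if l = 0 \<or> (i \<le> max_effective_row n \<sigma> \<and> l = n - i + 1) then 0
      else if max_effective_row n \<sigma> < i then real l
      else measure_pmf.expectation (pair_pmf (uniform_subset n i l) (uniform_subset n i l))
             (\<lambda>(S, S'). real (step_evals n \<sigma> i S S') +
                (\<Sum>C\<in>#step_calls n \<sigma> i S S'. mst_cost n \<sigma> (i + 1) (card (fst C)))))"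
  by pat_completeness auto
termination
  by (relation "Wellfounded.measure (\<lambda>(n, \<sigma>, i, l). max_effective_row n \<sigma> + 1 - i)") auto

text \<open>The equation loops as a simplification rule.\<close>

declare mst_cost.simps [simp del]

definition E_mst :: "nat \<Rightarrow> (nat \<Rightarrow> nat \<Rightarrow> nat \<Rightarrow> nat) \<Rightarrow> nat \<Rightarrow> real" where
  "E_mst n \<sigma> m = mst_cost n \<sigma> 1 m"

definition eff_mst ::
    "nat \<Rightarrow> (nat \<Rightarrow> nat) set \<Rightarrow> (nat \<Rightarrow> nat \<Rightarrow> nat \<Rightarrow> nat) \<Rightarrow> nat \<Rightarrow> real" where
  "eff_mst n G \<sigma> m = E_mst n \<sigma> m / (real (card G) * real m)"

end

theory Submission
  imports Defs
begin

text \<open>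
  Every call at level \<open>i\<close> makes at most \<open>c i + 1\<close> further calls and at most \<open>c i * l\<close> direct
  evaluations. If \<open>K i\<close> denotes the product of the \<open>c j + 1\<close> over \<open>j \<ge> i\<close>, the cost at level \<open>i\<close>
  is therefore at most \<open>l * K i * A i\<close>, where \<open>A i\<close> is 1 plus the sum of the terms
  \<open>c j / (c j + 1) / 2 ^ r(j)\<close> for \<open>j \<ge> i\<close>, because \<open>K (j + 1)\<close> is at least \<open>2 ^ r(j)\<close>.
  The factor \<open>\<rho>\<^sup>2\<close> is gained at level 1 only: if the gap vanishes there, only the element branch
  does anything, and it needs both \<open>1 \<in> S\<close> and \<open>j \<in> S'\<close> for a \<open>j\<close> in the orbit of 1, two
  independent events of probability \<open>m / n\<close>.
\<close>

subsection \<open>Switch tables and the group order\<close>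

lemma switch_table_cases:
  assumes "is_switch_table n G \<sigma>" "i \<in> {1..n}" "j \<in> {1..n}"
  shows "i < j \<and> switch_candidate G i j (\<sigma> i j) \<or>
    \<sigma> i j = id \<and> \<not> (i < j \<and> (\<exists>g. switch_candidate G i j g))"
proof -
  have "if i < j \<and> (\<exists>g. switch_candidate G i j g)
      then switch_candidate G i j (\<sigma> i j) else \<sigma> i j = id"
    using assms unfolding is_switch_table_def by blast
  thus ?thesis by (simp split: if_split_asm)
qed

lemma nontriv_cols_subset:
  assumes "is_switch_table n G \<sigma>" "i \<in> {1..n}"
  shows "nontriv_cols n \<sigma> i \<subseteq> {i<..n}"
  using switch_table_cases[OF assms] unfolding nontriv_cols_def by fastforce

lemma nontriv_cols_candidate:
  assumes "is_switch_table n G \<sigma>" "i \<in> {1..n}" "j \<in> nontriv_cols n \<sigma> i"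
  shows "switch_candidate G i j (\<sigma> i j)"
  using switch_table_cases[OF assms(1,2)] assms(3) unfolding nontriv_cols_def by blast

lemma finite_nontriv_cols [simp]: "finite (nontriv_cols n \<sigma> i)"
  by (simp add: nontriv_cols_def)

lemma effective_rows_iff:
  "i \<in> effective_rows n \<sigma> \<longleftrightarrow> 0 < i \<and> i \<le> n \<and> 0 < num_switches n \<sigma> i"
  by (auto simp: effective_rows_def num_switches_def card_gt_0_iff)

lemma finite_effective_rows [simp]: "finite (effective_rows n \<sigma>)"
  by (simp add: effective_rows_def)

lemma le_max_effective_row:
  "0 < i \<Longrightarrow> i \<le> n \<Longrightarrow> 0 < num_switches n \<sigma> i \<Longrightarrow> i \<le> max_effective_row n \<sigma>"
  by (simp add: max_effective_row_def effective_rows_iff)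

lemma max_effective_row_le: "max_effective_row n \<sigma> \<le> n"
  unfolding max_effective_row_def by (subst Max_le_iff) (auto simp: effective_rows_def)

section \<open>The stabilizer chain of \<open>G\<close> and a lower bound for the group
  order\<close>

definition pointwise_stabilizer :: "(nat \<Rightarrow> nat) set \<Rightarrow> nat \<Rightarrow> (nat \<Rightarrow> nat) set" where
  "pointwise_stabilizer G i = {g \<in> G. \<forall>t\<in>{1..<i}. g t = t}"

lemma subgroup_sym_group_permutes:
  assumes "subgroup G (sym_group n)" "g \<in> G"
  shows "g permutes {1..n}"
  using subgroup.mem_carrier[OF assms] by (simp add: sym_group_def)

lemma subgroup_sym_group_comp:
  assumes "subgroup G (sym_group n)" "g \<in> G" "h \<in> G"
  shows "g \<circ> h \<in> G"
  using subgroup.m_closed[OF assms] by (simp add: sym_group_def)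

lemma subgroup_sym_group_id:
  assumes "subgroup G (sym_group n)"
  shows "id \<in> G"
  using subgroup.one_closed[OF assms] by (simp add: sym_group_def)

lemma subgroup_sym_group_finite:
  assumes "subgroup G (sym_group n)"
  shows "finite G"
  by (rule finite_subset[OF _ finite_permutations[of "{1..n}"]])
    (use subgroup_sym_group_permutes[OF assms] in auto)

text \<open>The products \<open>h \<circ> \<sigma> i j\<close>, with \<open>h\<close> fixing all
  points up to \<open>i\<close>, are pairwise distinct elements of the stabilizer at
  \<open>i\<close>: the column \<open>j\<close> is recovered as the preimage of \<open>i\<close>,
  and then \<open>h\<close> by cancelling \<open>\<sigma> i j\<close>. This is the half of the
  orbit-stabilizer theorem that bounds the order from below.\<close>

lemma card_stabilizer_step:
  assumes G: "subgroup G (sym_group n)" and tab: "is_switch_table n G \<sigma>" and i: "i \<in> {1..n}"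
  shows "(num_switches n \<sigma> i + 1) * card (pointwise_stabilizer G (Suc i))
           \<le> card (pointwise_stabilizer G i)"
proof -
  \<comment> \<open>The column \<open>i\<close> itself joins with \<open>\<sigma> i i = id\<close>
    as the representative of the trivial coset; it supplies the \<open>+ 1\<close>.\<close>
  define J where "J = insert i (nontriv_cols n \<sigma> i)"
  have sub: "nontriv_cols n \<sigma> i \<subseteq> {i<..n}" by (rule nontriv_cols_subset[OF tab i])
  have cJ: "card J = num_switches n \<sigma> i + 1"
    using sub unfolding J_def num_switches_def by (subst card_insert_disjoint) auto
  have sii: "\<sigma> i i = id" using switch_table_cases[OF tab i i] by blast
  have cand: "switch_candidate G i j (\<sigma> i j)" if "j \<in> J" for j
    using that nontriv_cols_candidate[OF tab i] sii subgroup_sym_group_id[OF G]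
    unfolding J_def by (auto simp: switch_candidate_def)
  let ?f = "\<lambda>(j, h). h \<circ> \<sigma> i j"
  have img: "?f ` (J \<times> pointwise_stabilizer G (Suc i)) \<subseteq> pointwise_stabilizer G i"
    using cand subgroup_sym_group_comp[OF G]
    by (auto simp: switch_candidate_def pointwise_stabilizer_def)
  have inj: "inj_on ?f (J \<times> pointwise_stabilizer G (Suc i))"
  proof (rule inj_onI, clarify)
    fix j h j' h'
    assume j: "j \<in> J" "j' \<in> J"
      and h: "h \<in> pointwise_stabilizer G (Suc i)" "h' \<in> pointwise_stabilizer G (Suc i)"
      and eq: "h \<circ> \<sigma> i j = h' \<circ> \<sigma> i j'"
    have hi: "h i = i" "h' i = i" "h \<in> G" "h' \<in> G"
      using h i by (auto simp: pointwise_stabilizer_def)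
    have s: "\<sigma> i j \<in> G" "\<sigma> i j j = i" "\<sigma> i j' j' = i"
      using cand[OF j(1)] cand[OF j(2)] by (auto simp: switch_candidate_def)
    \<comment> \<open>Both sides equal \<open>i\<close>: on the left \<open>\<sigma> i j\<close>
      sends \<open>j\<close> to \<open>i\<close>, which \<open>h\<close> fixes; on the right, after
      rewriting by \<open>eq\<close>, the same holds for \<open>j'\<close> and
      \<open>h'\<close>.\<close>
    have "(h \<circ> \<sigma> i j) j = (h \<circ> \<sigma> i j) j'"
      using hi s by (subst (2) eq) simp
    moreover have "inj (h \<circ> \<sigma> i j)"
      using permutes_inj subgroup_sym_group_permutes[OF G] subgroup_sym_group_comp[OF G] hi s
      by blast
    ultimately have jj: "j = j'" by (rule injD[rotated])
    have "surj (\<sigma> i j)" using permutes_surj subgroup_sym_group_permutes[OF G] s by blast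
    hence "h = h'" using eq unfolding jj by (metis comp_apply ext surjD)
    with jj show "j = j' \<and> h = h'" by simp
  qed
  have "card (J \<times> pointwise_stabilizer G (Suc i)) \<le> card (pointwise_stabilizer G i)"
    using card_mono[OF _ img] card_image[OF inj] subgroup_sym_group_finite[OF G]
    by (simp add: pointwise_stabilizer_def)
  thus ?thesis by (simp add: card_cartesian_product cJ)
qed

text \<open>The stabilizer step telescopes downwards from \<open>Suc r\<close>, where the identity
  already gives order at least 1. At index 1 no point has to be fixed, so the stabilizer there is
  \<open>G\<close>.\<close>

lemma prod_switches_le_card:
  assumes G: "subgroup G (sym_group n)" and tab: "is_switch_table n G \<sigma>" and r: "r \<le> n"
  shows "(\<Prod>j=1..r. num_switches n \<sigma> j + 1) \<le> card G"
proof -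
  have "(\<Prod>j=i..r. num_switches n \<sigma> j + 1) \<le> card (pointwise_stabilizer G i)"
    if "1 \<le> i" "i \<le> Suc r" for i
    using that(2,1)
  proof (induction i rule: inc_induct)
    case base
    have "id \<in> pointwise_stabilizer G (Suc r)"
      using subgroup_sym_group_id[OF G] by (simp add: pointwise_stabilizer_def)
    moreover have "finite (pointwise_stabilizer G (Suc r))"
      using subgroup_sym_group_finite[OF G] by (simp add: pointwise_stabilizer_def)
    ultimately have "0 < card (pointwise_stabilizer G (Suc r))"
      using card_gt_0_iff by blast
    thus ?case by simp
  next
    case (step i)
    have "(\<Prod>j=i..r. num_switches n \<sigma> j + 1)
        = (num_switches n \<sigma> i + 1) * (\<Prod>j=Suc i..r. num_switches n \<sigma> j + 1)"
      using step by (subst prod.atLeast_Suc_atMost) auto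
    also have "\<dots> \<le> (num_switches n \<sigma> i + 1) * card (pointwise_stabilizer G (Suc i))"
      using step by (intro mult_left_mono) auto
    also have "\<dots> \<le> card (pointwise_stabilizer G i)"
      using step r by (intro card_stabilizer_step[OF G tab]) auto
    finally show ?case .
  qed
  from this[of 1] show ?thesis by (simp add: pointwise_stabilizer_def)
qed

subsection \<open>The transitivity gap and effective rows\<close>

lemma falling_fact_pos:
  assumes "real l \<le> x"
  shows "0 < falling_fact x l"
  unfolding falling_fact_def using assms by (intro prod_pos) auto

text \<open>Where the quotient applies, both falling factorials are positive, so the gap vanishes
  exactly in the default case. For a switch table this says that the \<open>n - i - c\<close> points
  of \<open>{i..n}\<close> other than \<open>i\<close> and its non-trivial columns are too few to
  hold an \<open>l\<close>-subset.\<close>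

lemma transitivity_gap_eq_0_iff:
  assumes "i \<le> n"
  shows "transitivity_gap n \<sigma> i l = 0 \<longleftrightarrow> n < i + num_switches n \<sigma> i + l"
proof (cases "int l \<le> int n - int i - int (num_switches n \<sigma> i)")
  case True
  hence le: "real l \<le> real n - real i - real (num_switches n \<sigma> i)" by linarith
  have "0 < falling_fact (real n - real i + 1 - (real (num_switches n \<sigma> i) + 1)) l"
    and "0 < falling_fact (real n - real i + 1) l"
    using le by (auto intro!: falling_fact_pos)
  thus ?thesis using True by (simp add: transitivity_gap_def)
next
  case False
  thus ?thesis by (auto simp: transitivity_gap_def)
qed

text \<open>In row 1 no point has to be fixed, so transitivity provides a candidate for every
  \<open>j > 1\<close>; the chosen entry moves \<open>j\<close> to 1 and thus differs from the
  identity.\<close>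

lemma num_switches_transitive:
  assumes tab: "is_switch_table n G \<sigma>" and n: "1 \<le> n"
    and trans: "\<forall>x\<in>{1..n}. \<forall>y\<in>{1..n}. \<exists>g\<in>G. g x = y"
  shows "num_switches n \<sigma> 1 = n - 1"
proof -
  have "{1<..n} \<subseteq> nontriv_cols n \<sigma> 1"
  proof
    fix j assume j: "j \<in> {1<..n}"
    then obtain g where "g \<in> G" "g j = 1" using trans n by fastforce
    hence g: "switch_candidate G 1 j g" by (auto simp: switch_candidate_def)
    have "switch_candidate G 1 j (\<sigma> 1 j)"
      using switch_table_cases[OF tab, of 1 j] j n g by auto
    thus "j \<in> nontriv_cols n \<sigma> 1"
      using j by (auto simp: switch_candidate_def nontriv_cols_def)
  qed
  moreover have "nontriv_cols n \<sigma> 1 \<subseteq> {1<..n}"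
    using nontriv_cols_subset[OF tab, of 1] n by simp
  ultimately have "nontriv_cols n \<sigma> 1 = {1<..n}" by (rule equalityI[rotated])
  thus ?thesis by (simp add: num_switches_def)
qed

section \<open>Weights of the effective rows and tail products\<close>

lemma effective_rows_above_less:
  assumes "i \<in> effective_rows n \<sigma>" "j < i"
  shows "effective_rows_above n \<sigma> i < effective_rows_above n \<sigma> j"
  unfolding effective_rows_above_def using assms by (intro psubset_card_mono) auto

text \<open>Ineffective rows have \<open>c = 0\<close> and drop out. On the effective rows the
  exponents are distinct and the fractions are below 1, so the sum is dominated by the geometric
  series of ratio 1/2.\<close>

lemma sum_weights_le_2:
  "(\<Sum>j=1..max_effective_row n \<sigma>. 1 / 2 ^ effective_rows_above n \<sigma> j *
      (real (num_switches n \<sigma> j) / (real (num_switches n \<sigma> j) + 1))) \<le> 2"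
  (is "sum ?w _ \<le> 2")
proof -
  let ?E = "effective_rows n \<sigma>"
  have inj: "inj_on (effective_rows_above n \<sigma>) ?E"
    by (intro linorder_inj_onI) (auto dest: effective_rows_above_less)
  have "sum ?w {1..max_effective_row n \<sigma>} = sum ?w ?E"
    by (intro sum.mono_neutral_right)
      (use max_effective_row_le[of n \<sigma>] in
        \<open>auto simp: effective_rows_iff intro!: le_max_effective_row\<close>)
  also have "\<dots> \<le> (\<Sum>j\<in>?E. (1/2) ^ effective_rows_above n \<sigma> j)"
    unfolding power_one_over by (intro sum_mono mult_left_le) auto
  also have "\<dots> = (\<Sum>s\<in>effective_rows_above n \<sigma> ` ?E. (1/2::real) ^ s)"
    by (simp add: sum.reindex[OF inj])
  also have "\<dots> \<le> (\<Sum>s. (1/2::real) ^ s)"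
    by (intro sum_le_suminf) (auto intro: summable_geometric)
  also have "\<dots> = 2" by (simp add: suminf_geometric)
  finally show ?thesis .
qed

text \<open>The number \<open>K i\<close> of the outline. For a switch table of a subgroup and
  \<open>1 \<le> i\<close> it is the order of \<open>pointwise_stabilizer G i\<close>; beyond the
  last effective row it is the empty product 1.\<close>

definition tail_order :: "nat \<Rightarrow> (nat \<Rightarrow> nat \<Rightarrow> nat \<Rightarrow> nat) \<Rightarrow> nat \<Rightarrow> nat" where
  "tail_order n \<sigma> i = (\<Prod>j=i..max_effective_row n \<sigma>. num_switches n \<sigma> j + 1)"

lemma tail_order_Suc:
  "i \<le> max_effective_row n \<sigma> \<Longrightarrow>
     tail_order n \<sigma> i = (num_switches n \<sigma> i + 1) * tail_order n \<sigma> (Suc i)"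
  unfolding tail_order_def by (rule prod.atLeast_Suc_atMost)

text \<open>Every effective row beyond \<open>i\<close> contributes a factor of at least 2, every
  other row the factor 1.\<close>

lemma power_effective_rows_le_tail_order:
  "2 ^ effective_rows_above n \<sigma> i \<le> tail_order n \<sigma> (Suc i)"
proof -
  let ?E = "{j \<in> effective_rows n \<sigma>. i < j}"
  have "2 ^ effective_rows_above n \<sigma> i = (\<Prod>j\<in>?E. 2::nat)"
    by (simp add: effective_rows_above_def)
  also have "\<dots> \<le> (\<Prod>j\<in>?E. num_switches n \<sigma> j + 1)"
    by (intro prod_mono) (auto simp: effective_rows_iff)
  also have "\<dots> = tail_order n \<sigma> (Suc i)"
    unfolding tail_order_def
    by (intro prod.mono_neutral_left)
      (use max_effective_row_le[of n \<sigma>] in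
        \<open>auto simp: effective_rows_iff intro!: le_max_effective_row\<close>)
  finally show ?thesis .
qed

text \<open>One level of the recursion for the cost per element: \<open>c\<close> direct evaluations
  and \<open>c + 1\<close> calls. The calls already account for the right-hand side except for
  \<open>tail_order n \<sigma> i * a i\<close>, and this term is at least \<open>c\<close>.\<close>

lemma cost_bound_step:
  fixes a :: "nat \<Rightarrow> real"
  assumes i: "i \<le> max_effective_row n \<sigma>"
  defines "a \<equiv> \<lambda>j. 1 / 2 ^ effective_rows_above n \<sigma> j *
      (real (num_switches n \<sigma> j) / (real (num_switches n \<sigma> j) + 1))"
  shows "real (num_switches n \<sigma> i) + real (num_switches n \<sigma> i + 1) *
        (real (tail_order n \<sigma> (Suc i)) * (1 + sum a {Suc i..max_effective_row n \<sigma>}))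
      \<le> real (tail_order n \<sigma> i) * (1 + sum a {i..max_effective_row n \<sigma>})"
proof -
  let ?c = "real (num_switches n \<sigma> i)" and ?K = "real (tail_order n \<sigma> (Suc i))"
  have "real (2 ^ effective_rows_above n \<sigma> i) \<le> ?K"
    using power_effective_rows_le_tail_order[of n \<sigma> i] by (simp only: of_nat_le_iff)
  hence "?c * 1 \<le> ?c * (?K / 2 ^ effective_rows_above n \<sigma> i)"
    by (intro mult_left_mono) (simp_all add: field_simps)
  \<comment> \<open>Expanding by \<open>c + 1\<close> turns the fraction into the weight
    \<open>a i\<close> and completes \<open>?K\<close> to the tail order at
    \<open>i\<close>.\<close>
  also have "\<dots> = (?c + 1) * ?K * a i"
  proof -
    have "x * (K / P) = (x + 1) * K * (1 / P * (x / (x + 1)))" if "0 \<le> x" for x K P :: real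
    proof -
      have "x + 1 \<noteq> 0" using that by linarith
      thus ?thesis by simp
    qed
    thus ?thesis by (simp add: a_def)
  qed
  finally have "?c \<le> (?c + 1) * ?K * a i" by simp
  moreover have "sum a {i..max_effective_row n \<sigma>} = a i + sum a {Suc i..max_effective_row n \<sigma>}"
    using i by (rule sum.atLeast_Suc_atMost)
  moreover have "real (tail_order n \<sigma> i) = (?c + 1) * ?K"
    by (simp add: tail_order_Suc[OF i] algebra_simps)
  ultimately show ?thesis by (simp add: algebra_simps)
qed

subsection \<open>Uniformly random subsets\<close>

abbreviation subsets_of_size :: "nat \<Rightarrow> nat \<Rightarrow> nat \<Rightarrow> nat set set" where
  "subsets_of_size n i l \<equiv> {S. S \<subseteq> {i..n} \<and> card S = l}"

lemma card_subsets_of_size: "card (subsets_of_size n i l) = (Suc n - i) choose l"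
  using n_subsets[of "{i..n}" l] by simp

lemma finite_subsets_of_size [simp]: "finite (subsets_of_size n i l)"
  by (rule finite_subset[of _ "Pow {i..n}"]) auto

lemma card_subsets_of_size_pos: "l \<le> Suc n - i \<Longrightarrow> 0 < card (subsets_of_size n i l)"
  by (simp only: card_subsets_of_size zero_less_binomial)

lemma subsets_of_size_ne: "l \<le> Suc n - i \<Longrightarrow> subsets_of_size n i l \<noteq> {}"
  using card_subsets_of_size_pos by (metis card.empty less_irrefl)

lemma card_subsets_containing:
  assumes "j \<in> {i..n}" "1 \<le> l"
  shows "card {S \<in> subsets_of_size n i l. j \<in> S} = (n - i) choose (l - 1)"
proof -
  have "bij_betw (insert j) {S. S \<subseteq> {i..n} - {j} \<and> card S = l - 1}
          {S \<in> subsets_of_size n i l. j \<in> S}"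
  proof (rule bij_betwI[where g = "\<lambda>S. S - {j}"])
    show "insert j \<in> {S. S \<subseteq> {i..n} - {j} \<and> card S = l - 1}
        \<rightarrow> {S \<in> subsets_of_size n i l. j \<in> S}"
    proof
      fix S assume S: "S \<in> {S. S \<subseteq> {i..n} - {j} \<and> card S = l - 1}"
      hence "finite S" "j \<notin> S" by (auto intro: finite_subset[of _ "{i..n}"])
      thus "insert j S \<in> {S \<in> subsets_of_size n i l. j \<in> S}"
        using S assms by auto
    qed
  next
    show "(\<lambda>S. S - {j}) \<in> {S \<in> subsets_of_size n i l. j \<in> S}
        \<rightarrow> {S. S \<subseteq> {i..n} - {j} \<and> card S = l - 1}"
    proof
      fix S assume "S \<in> {S \<in> subsets_of_size n i l. j \<in> S}"
      hence S: "S \<subseteq> {i..n}" "card S = l" "j \<in> S" by simp_all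
      thus "S - {j} \<in> {S. S \<subseteq> {i..n} - {j} \<and> card S = l - 1}"
        using card_Diff_singleton[OF S(3)] by blast
    qed
  next
    fix S assume "S \<in> {S. S \<subseteq> {i..n} - {j} \<and> card S = l - 1}"
    thus "insert j S - {j} = S" by blast
  next
    fix S assume "S \<in> {S \<in> subsets_of_size n i l. j \<in> S}"
    thus "insert j (S - {j}) = S" by blast
  qed
  hence "card {S \<in> subsets_of_size n i l. j \<in> S}
      = card {S. S \<subseteq> {i..n} - {j} \<and> card S = l - 1}"
    by (simp add: bij_betw_same_card)
  also have "\<dots> = card ({i..n} - {j}) choose (l - 1)"
    by (rule n_subsets) simp
  also have "card ({i..n} - {j}) = n - i" using assms by simp
  finally show ?thesis .
qed

text \<open>The probability that a random \<open>l\<close>-subset contains a given point. The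
  quotient of binomial coefficients collapses by the absorption identity for
  \<open>N = n - i + 1\<close>.\<close>

lemma sum_indicator_subsets:
  assumes "j \<in> {i..n}" "1 \<le> l" "l \<le> Suc n - i"
  shows "(\<Sum>S\<in>subsets_of_size n i l. of_bool (j \<in> S)) / real (card (subsets_of_size n i l))
           = real l / real (Suc n - i)"
proof -
  have "l * (Suc n - i choose l) = (Suc n - i) * (n - i choose (l - 1))"
    using Suc_times_binomial_eq[of "n - i" "l - 1"] assms by (simp add: Suc_diff_le mult.commute)
  hence absorb: "real (n - i choose (l - 1)) * real (Suc n - i)
      = real l * real (Suc n - i choose l)"
    by (metis of_nat_mult mult.commute)
  have pos: "real (Suc n - i choose l) \<noteq> 0" "real (Suc n - i) \<noteq> 0" using assms by auto
  have "subsets_of_size n i l \<inter> {S. j \<in> S} = {S \<in> subsets_of_size n i l. j \<in> S}" by blast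
  hence "(\<Sum>S\<in>subsets_of_size n i l. of_bool (j \<in> S)) = real (n - i choose (l - 1))"
    using card_subsets_containing[OF assms(1,2)]
    by (simp only: sum_of_bool_eq finite_subsets_of_size)
  thus ?thesis
    using absorb unfolding card_subsets_of_size by (simp only: frac_eq_eq[OF pos])
qed

text \<open>The pair is uniform on a finite product, so its expectation is a plain average; from
  here on only finite sums are estimated.\<close>

lemma expectation_uniform_pair:
  assumes "l \<le> Suc n - i"
  shows "measure_pmf.expectation (pair_pmf (uniform_subset n i l) (uniform_subset n i l)) f
     = (\<Sum>P\<in>subsets_of_size n i l \<times> subsets_of_size n i l. f P)
         / (real (card (subsets_of_size n i l)))\<^sup>2"
proof -
  let ?A = "subsets_of_size n i l"
  have ne: "?A \<noteq> {}" by (rule subsets_of_size_ne[OF assms])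
  have p: "pmf (uniform_subset n i l) S = 1 / real (card ?A)" if "S \<in> ?A" for S
    using that unfolding uniform_subset_def pmf_of_set[OF ne finite_subsets_of_size]
    by (simp only: indicator_simps)
  have "measure_pmf.expectation (pair_pmf (uniform_subset n i l) (uniform_subset n i l)) f
     = (\<Sum>P\<in>?A \<times> ?A. f P * pmf (pair_pmf (uniform_subset n i l) (uniform_subset n i l)) P)"
    by (rule integral_measure_pmf_real)
      (use ne in \<open>simp_all add: uniform_subset_def set_pmf_of_set del: mem_Collect_eq\<close>)
  also have "\<dots> = (\<Sum>P\<in>?A \<times> ?A. f P / (real (card ?A))\<^sup>2)"
  proof (intro sum.cong refl)
    fix P assume "P \<in> ?A \<times> ?A"
    then obtain S S' where "P = (S, S')" "S \<in> ?A" "S' \<in> ?A" by (rule SigmaE)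
    thus "f P * pmf (pair_pmf (uniform_subset n i l) (uniform_subset n i l)) P
        = f P / (real (card ?A))\<^sup>2"
      by (simp add: p pmf_pair power2_eq_square del: mem_Collect_eq)
  qed
  finally show ?thesis unfolding sum_divide_distrib .
qed

lemma expectation_uniform_pair_le:
  fixes f :: "nat set \<times> nat set \<Rightarrow> real"
  assumes "l \<le> Suc n - i"
    and "\<And>S S'. S \<in> subsets_of_size n i l \<Longrightarrow> S' \<in> subsets_of_size n i l \<Longrightarrow> f (S, S') \<le> B"
  shows "measure_pmf.expectation (pair_pmf (uniform_subset n i l) (uniform_subset n i l)) f \<le> B"
proof -
  let ?A = "subsets_of_size n i l"
  have "0 < card ?A" by (rule card_subsets_of_size_pos[OF assms(1)])
  hence pos: "0 < (real (card ?A))\<^sup>2" by (intro zero_less_power) (simp only: of_nat_0_less_iff)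
  have "(\<Sum>P\<in>?A \<times> ?A. f P) \<le> real (card (?A \<times> ?A)) * B"
    by (rule sum_bounded_above) (use assms(2) in auto)
  also have "\<dots> = B * (real (card ?A))\<^sup>2"
    unfolding card_cartesian_product power2_eq_square of_nat_mult by (rule mult.commute)
  finally show ?thesis
    unfolding expectation_uniform_pair[OF assms(1)] pos_divide_le_eq[OF pos] .
qed

subsection \<open>The cost recursion\<close>

lemma step_evals_le: "step_evals n \<sigma> i S S' \<le> num_switches n \<sigma> i * card S"
proof -
  have "card (nontriv_cols n \<sigma> i \<inter> S') \<le> num_switches n \<sigma> i"
    unfolding num_switches_def by (intro card_mono) auto
  hence "card (nontriv_cols n \<sigma> i \<inter> S') * (card S - 1) \<le> num_switches n \<sigma> i * card S"
    by (rule mult_le_mono) simp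
  thus ?thesis unfolding step_evals_def by (simp add: num_switches_def)
qed

lemma size_step_calls_le: "size (step_calls n \<sigma> i S S') \<le> num_switches n \<sigma> i + 1"
proof -
  have "card (nontriv_cols n \<sigma> i \<inter> S') \<le> num_switches n \<sigma> i"
    unfolding num_switches_def by (intro card_mono) auto
  thus ?thesis unfolding step_calls_def by (auto simp: num_switches_def)
qed

text \<open>A recursive call enters the cost only through its level and the size of its first set,
  which is \<open>S\<close> or \<open>S - {i}\<close>.\<close>

lemma step_calls_card_le:
  assumes "finite S" "C \<in># step_calls n \<sigma> i S S'"
  shows "card (fst C) \<le> card S"
proof -
  have "fst C \<subseteq> S" using assms(2) unfolding step_calls_def by (auto split: if_splits)
  thus ?thesis by (rule card_mono[OF assms(1)])
qed

section \<open>A bound for the expected cost at an arbitrary level\<close>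

lemma sum_mset_bounded_above:
  fixes f :: "'a \<Rightarrow> real"
  assumes "\<And>x. x \<in># M \<Longrightarrow> f x \<le> b"
  shows "(\<Sum>x\<in>#M. f x) \<le> real (size M) * b"
  using assms by (induction M) (force simp: algebra_simps)+

text \<open>A worst-case estimate: the integrand is bounded for every pair \<open>S\<close>,
  \<open>S'\<close>, hence so is its mean. The induction runs over the number of levels left, and
  \<open>cost_bound_step\<close> closes each step.\<close>

lemma mst_cost_le:
  assumes tab: "is_switch_table n G \<sigma>" and "1 \<le> i" "l \<le> Suc n - i"
  shows "mst_cost n \<sigma> i l \<le> real l * (real (tail_order n \<sigma> i) *
           (1 + (\<Sum>j=i..max_effective_row n \<sigma>. 1 / 2 ^ effective_rows_above n \<sigma> j *
              (real (num_switches n \<sigma> j) / (real (num_switches n \<sigma> j) + 1)))))"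
  (is "_ \<le> real l * ?B i")
  using assms(2,3)
proof (induction "Suc (max_effective_row n \<sigma>) - i" arbitrary: i l)
  \<comment> \<open>Past the last effective row the final comparison costs \<open>l\<close>; product
    and sum are empty, so the bound is \<open>l\<close> too.\<close>
  case 0
  thus ?case by (subst mst_cost.simps) (simp add: tail_order_def)
next
  case (Suc d)
  have nonneg: "0 \<le> ?B i'" for i'
    by (intro mult_nonneg_nonneg add_nonneg_nonneg sum_nonneg) auto
  have ir: "i \<le> max_effective_row n \<sigma>" using Suc.hyps(2) by simp
  hence i: "i \<in> {1..n}" using Suc.prems max_effective_row_le[of n \<sigma>] by simp
  show ?case
  proof (cases "l = 0 \<or> l = n - i + 1")
    case True
    thus ?thesis using nonneg[of i] ir by (subst mst_cost.simps) auto
  next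
    case False
    \<comment> \<open>With the full set excluded, every call fits into the \<open>n - i\<close>
      points of the next level, as the induction hypothesis demands.\<close>
    hence l: "l \<le> n - i" using Suc.prems i by auto
    define c where "c = num_switches n \<sigma> i"
    have "real (step_evals n \<sigma> i S S') +
          (\<Sum>C\<in>#step_calls n \<sigma> i S S'. mst_cost n \<sigma> (i + 1) (card (fst C)))
        \<le> real l * (c + (c + 1) * ?B (Suc i))"
      if S: "S \<in> subsets_of_size n i l" for S S'
    proof -
      have fin: "finite S" using S by (auto intro: finite_subset[of _ "{i..n}"])
      have call: "mst_cost n \<sigma> (i + 1) (card (fst C)) \<le> real l * ?B (Suc i)"
        if "C \<in># step_calls n \<sigma> i S S'" for C
      proof -
        have le: "card (fst C) \<le> l" using step_calls_card_le[OF fin that] S by simp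
        hence "mst_cost n \<sigma> (Suc i) (card (fst C)) \<le> real (card (fst C)) * ?B (Suc i)"
          using Suc.hyps(2) l by (intro Suc.hyps(1)) auto
        also have "\<dots> \<le> real l * ?B (Suc i)"
          using le nonneg by (intro mult_right_mono) auto
        finally show ?thesis by simp
      qed
      have "(\<Sum>C\<in>#step_calls n \<sigma> i S S'. mst_cost n \<sigma> (i + 1) (card (fst C)))
          \<le> real (size (step_calls n \<sigma> i S S')) * (real l * ?B (Suc i))"
        by (rule sum_mset_bounded_above) (rule call)
      also have "\<dots> \<le> real (c + 1) * (real l * ?B (Suc i))"
        using size_step_calls_le[of n \<sigma> i S S'] nonneg[of "Suc i"]
        unfolding c_def by (intro mult_right_mono) (simp_all only: of_nat_le_iff mult_nonneg_nonneg of_nat_0_le_iff)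
      finally have "(\<Sum>C\<in>#step_calls n \<sigma> i S S'. mst_cost n \<sigma> (i + 1) (card (fst C)))
          \<le> real (c + 1) * (real l * ?B (Suc i))" .
      moreover have "real (step_evals n \<sigma> i S S') \<le> real (c * l)"
        using step_evals_le[of n \<sigma> i S S'] S unfolding c_def of_nat_le_iff by simp
      ultimately have "real (step_evals n \<sigma> i S S') +
          (\<Sum>C\<in>#step_calls n \<sigma> i S S'. mst_cost n \<sigma> (i + 1) (card (fst C)))
        \<le> real (c * l) + real (c + 1) * (real l * ?B (Suc i))" by (rule add_mono[rotated])
      also have "\<dots> = real l * (c + (c + 1) * ?B (Suc i))" by (simp add: algebra_simps)
      finally show ?thesis .
    qed
    hence "mst_cost n \<sigma> i l \<le> real l * (c + (c + 1) * ?B (Suc i))"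
      using False ir Suc.prems
      by (subst mst_cost.simps) (auto intro!: expectation_uniform_pair_le)
    also have "c + (c + 1) * ?B (Suc i) \<le> ?B i"
      unfolding c_def by (rule cost_bound_step[OF ir])
    hence "real l * (c + (c + 1) * ?B (Suc i)) \<le> real l * ?B i"
      by (intro mult_left_mono) auto
    finally show ?thesis .
  qed
qed

text \<open>An exact value: the non-element branch always stops, and each of the
  \<open>c + 1\<close> calls of the element branch needs \<open>1 \<in> S\<close> and one prescribed
  point in \<open>S'\<close>. These independent events have probability \<open>m / n\<close> each; a
  call costs \<open>T\<close>, and each of the \<open>c\<close> switches costs \<open>m - 1\<close>
  more.\<close>

lemma mst_cost_gap_0:
  assumes tab: "is_switch_table n G \<sigma>" and m: "1 \<le> m" "m < n"
    and gap: "transitivity_gap n \<sigma> 1 m = 0"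
  defines "c \<equiv> real (num_switches n \<sigma> 1)" and "T \<equiv> mst_cost n \<sigma> 2 (m - 1)"
  shows "mst_cost n \<sigma> 1 m = (real m / real n)\<^sup>2 * (c * real (m - 1) + (c + 1) * T)"
proof -
  define A where "A = subsets_of_size n 1 m"
  have A: "S \<subseteq> {1..n}" "card S = m" "finite S" if "S \<in> A" for S
    using that finite_subset[of S "{1..n}"] unfolding A_def by blast+
  let ?J = "nontriv_cols n \<sigma> 1"
  have sub: "?J \<subseteq> {1<..n}" using nontriv_cols_subset[OF tab, of 1] m by simp
  have cJ: "c = real (card ?J)" by (simp add: c_def num_switches_def)
  have cm: "n < 1 + card ?J + m"
    using gap m by (simp add: transitivity_gap_eq_0_iff num_switches_def)
  \<comment> \<open>Since \<open>n \<le> c + m\<close> and \<open>m < n\<close>, row 1 has a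
    non-trivial entry; level 1 is therefore a branching level.\<close>
  hence r: "1 \<le> max_effective_row n \<sigma>"
    using m by (intro le_max_effective_row) (unfold num_switches_def, linarith+)
  \<comment> \<open>Pigeonhole: \<open>insert 1 ?J\<close> and \<open>S'\<close> together have more
    than \<open>n\<close> elements, so they cannot be disjoint in \<open>{1..n}\<close>.\<close>
  have meet: "1 \<in> S' \<or> ?J \<inter> S' \<noteq> {}" if "S' \<in> A" for S'
  proof (rule ccontr)
    assume "\<not> ?thesis"
    hence dis: "insert 1 ?J \<inter> S' = {}" by auto
    have "card (insert 1 ?J) + card S' = card (insert 1 ?J \<union> S')"
      using dis A(3)[OF that] by (intro card_Un_disjoint[symmetric]) simp_all
    also have "\<dots> \<le> card {1..n}"
      using A(1)[OF that] sub m by (intro card_mono) auto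
    finally have "card (insert 1 ?J) + m \<le> n" using A(2)[OF that] by simp
    moreover have "card (insert 1 ?J) = Suc (card ?J)"
      using sub by (intro card_insert_disjoint) auto
    ultimately show False using cm by linarith
  qed
  define u where "u j S = (of_bool (j \<in> S) :: real)" for j :: nat and S :: "nat set"
  \<comment> \<open>The work of one call as a combination of indicators: \<open>u 1 S'\<close> for
    the call without a switch, \<open>u j S'\<close> for the switch in column
    \<open>j\<close>.\<close>
  have step: "real (step_evals n \<sigma> 1 S S') +
        (\<Sum>C\<in>#step_calls n \<sigma> 1 S S'. mst_cost n \<sigma> (1 + 1) (card (fst C)))
      = u 1 S * (u 1 S' * T + (\<Sum>j\<in>?J. u j S' * (real (m - 1) + T)))"
    if "S \<in> A" "S' \<in> A" for S S'
  proof (cases "1 \<in> S")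
    case True
    have "card S = m" "card (S - {1}) = m - 1" using True A[OF that(1)] by simp_all
    moreover have "(\<Sum>j\<in>?J. u j S') = real (card (?J \<inter> S'))"
      by (simp add: u_def sum_of_bool_eq Int_def)
    hence "(\<Sum>j\<in>?J. u j S' * (real (m - 1) + T))
        = real (card (?J \<inter> S')) * (real (m - 1) + T)"
      by (simp only: sum_distrib_right[symmetric])
    ultimately show ?thesis using True
      by (simp only:) (simp add: step_evals_def step_calls_def u_def T_def numeral_2_eq_2
        image_mset.compositionality comp_def distrib_left)
  next
    case False
    thus ?thesis using meet[OF that(2)] by (auto simp: step_evals_def step_calls_def u_def)
  qed
  define p where "p = real m / real n"
  define a where "a = real (card A)"
  have "0 < a"
    using card_subsets_of_size_pos[of m n 1] m unfolding a_def A_def by linarith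
  moreover have "(\<Sum>S\<in>A. u j S) / a = p" if "j \<in> {1..n}" for j
    using sum_indicator_subsets[OF that, of m] m
    unfolding u_def p_def a_def A_def by (simp only: diff_Suc_1 less_imp_le simp_thms)
  ultimately have u: "(\<Sum>S\<in>A. u j S) = p * a" if "j \<in> {1..n}" for j
    using that by (simp add: divide_eq_eq)
  \<comment> \<open>Independence in counting form: the summand is a function of \<open>S\<close>
    times a function of \<open>S'\<close>, so the double sum factors.\<close>
  have "(\<Sum>S\<in>A. \<Sum>S'\<in>A. u 1 S * (u 1 S' * T + (\<Sum>j\<in>?J. u j S' * (real (m - 1) + T))))
      = (\<Sum>S\<in>A. u 1 S) * (\<Sum>S'\<in>A. u 1 S' * T + (\<Sum>j\<in>?J. u j S' * (real (m - 1) + T)))"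
    by (simp add: sum_product)
  also have "(\<Sum>S'\<in>A. u 1 S' * T + (\<Sum>j\<in>?J. u j S' * (real (m - 1) + T)))
      = (\<Sum>S'\<in>A. u 1 S') * T + (\<Sum>j\<in>?J. (\<Sum>S'\<in>A. u j S') * (real (m - 1) + T))"
    unfolding sum.distrib sum_distrib_right by (subst sum.swap) simp
  also have "(\<Sum>j\<in>?J. (\<Sum>S'\<in>A. u j S') * (real (m - 1) + T))
      = (\<Sum>j\<in>?J. p * a * (real (m - 1) + T))"
    using sub by (intro sum.cong) (auto simp: u)
  also have "(\<Sum>S\<in>A. u 1 S) = p * a" using m by (intro u) simp
  also have "p * a * (p * a * T + (\<Sum>j\<in>?J. p * a * (real (m - 1) + T)))
      = p\<^sup>2 * a\<^sup>2 * (c * real (m - 1) + (c + 1) * T)"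
    by (simp add: cJ algebra_simps power2_eq_square)
  finally have total: "(\<Sum>S\<in>A. \<Sum>S'\<in>A. u 1 S * (u 1 S' * T +
      (\<Sum>j\<in>?J. u j S' * (real (m - 1) + T)))) = p\<^sup>2 * a\<^sup>2 * (c * real (m - 1) + (c + 1) * T)" .
  have "mst_cost n \<sigma> 1 m = (\<Sum>P\<in>A \<times> A. (\<lambda>(S, S'). real (step_evals n \<sigma> 1 S S') +
        (\<Sum>C\<in>#step_calls n \<sigma> 1 S S'. mst_cost n \<sigma> (1 + 1) (card (fst C)))) P) / a\<^sup>2"
    unfolding a_def A_def
    by (subst mst_cost.simps, subst expectation_uniform_pair) (use m r in simp_all)
  also have "(\<Sum>P\<in>A \<times> A. (\<lambda>(S, S'). real (step_evals n \<sigma> 1 S S') +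
        (\<Sum>C\<in>#step_calls n \<sigma> 1 S S'. mst_cost n \<sigma> (1 + 1) (card (fst C)))) P)
      = (\<Sum>S\<in>A. \<Sum>S'\<in>A. real (step_evals n \<sigma> 1 S S') +
        (\<Sum>C\<in>#step_calls n \<sigma> 1 S S'. mst_cost n \<sigma> (1 + 1) (card (fst C))))"
    by (simp only: sum.cartesian_product)
  also have "\<dots> = p\<^sup>2 * a\<^sup>2 * (c * real (m - 1) + (c + 1) * T)"
    unfolding total[symmetric] by (intro sum.cong refl step)
  finally show ?thesis using \<open>0 < a\<close> by (simp add: p_def)
qed

text \<open>The general bound at level 2 is inserted into the exact formula at level 1, which
  carries the factor \<open>(m / n)\<^sup>2\<close>. One more application of
  \<open>cost_bound_step\<close> collects row 1, and \<open>tail_order n \<sigma> 1\<close> is at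
  most the group order.\<close>

lemma eff_mst_le:
  assumes m: "1 \<le> m" "m < n" and G: "subgroup G (sym_group n)" and tab: "is_switch_table n G \<sigma>"
    and gap: "transitivity_gap n \<sigma> 1 m = 0"
  shows "eff_mst n G \<sigma> m \<le>
     (1 + (\<Sum>j=1..max_effective_row n \<sigma>. 1 / 2 ^ effective_rows_above n \<sigma> j *
        (real (num_switches n \<sigma> j) / (real (num_switches n \<sigma> j) + 1)))) * (subset_density n 1 m)\<^sup>2"
  (is "_ \<le> ?A 1 * _")
proof -
  let ?c = "real (num_switches n \<sigma> 1)" and ?T = "mst_cost n \<sigma> 2 (m - 1)"
  let ?B = "\<lambda>i. real (tail_order n \<sigma> i) * ?A i"
  have nonneg: "0 \<le> ?A i" for i
    by (intro add_nonneg_nonneg sum_nonneg) auto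
  have "n < 1 + num_switches n \<sigma> 1 + m" using gap m by (simp add: transitivity_gap_eq_0_iff)
  hence r: "1 \<le> max_effective_row n \<sigma>"
    using m by (intro le_max_effective_row) simp_all
  have "tail_order n \<sigma> 1 \<le> card G"
    using prod_switches_le_card[OF G tab max_effective_row_le] by (simp add: tail_order_def)
  moreover have "0 < tail_order n \<sigma> 1" by (simp add: tail_order_def)
  ultimately have k: "real (tail_order n \<sigma> 1) \<le> real (card G)" "0 < real (card G)"
    by simp_all
  have dens: "subset_density n 1 m = real m / real n"
    using m by (simp add: subset_density_def)
  have T: "?T \<le> real (m - 1) * ?B 2"
    using mst_cost_le[OF tab, of 2 "m - 1"] m by simp
  have "?c * real (m - 1) + (?c + 1) * ?T \<le> ?c * real (m - 1) + (?c + 1) * (real (m - 1) * ?B 2)"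
    using T by (intro add_left_mono mult_left_mono) auto
  also have "\<dots> = real (m - 1) * (?c + (?c + 1) * ?B 2)" by (simp add: algebra_simps)
  \<comment> \<open>The factor \<open>m - 1\<close>, common to the direct evaluations and the level
    2 bound, is relaxed to \<open>m\<close>.\<close>
  also have "\<dots> \<le> real m * ?B 1"
  proof (rule mult_mono)
    show "?c + (?c + 1) * ?B 2 \<le> ?B 1"
      using cost_bound_step[OF r] unfolding Suc_1 of_nat_add of_nat_1 .
  qed (use nonneg in simp_all)
  also have "\<dots> \<le> real m * (real (card G) * ?A 1)"
    using k nonneg by (intro mult_left_mono mult_right_mono) auto
  finally have "?c * real (m - 1) + (?c + 1) * ?T \<le> real m * (real (card G) * ?A 1)" .
  hence "mst_cost n \<sigma> 1 m \<le> (subset_density n 1 m)\<^sup>2 * (real m * (real (card G) * ?A 1))"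
    unfolding mst_cost_gap_0[OF tab m gap] dens by (intro mult_left_mono) auto
  thus ?thesis
    using k m unfolding eff_mst_def E_mst_def by (subst pos_divide_le_eq) (auto simp: mult_ac)
qed

theorem corollary5:
  fixes n m r :: nat
    and G :: "(nat \<Rightarrow> nat) set"
    and \<sigma> :: "nat \<Rightarrow> nat \<Rightarrow> nat \<Rightarrow> nat"
    and c :: "nat \<Rightarrow> nat"
    and \<mu> :: real
  assumes "1 \<le> m" and "m < n"
    and "subgroup G (sym_group n)"
    and "is_switch_table n G \<sigma>"
    and "r = max_effective_row n \<sigma>"
    and "\<And>i. i \<in> {1..r} \<Longrightarrow> c i = num_switches n \<sigma> i"
    and "\<mu> = (real n - 1) / real n"
  shows "((\<forall>x\<in>{1..n}. \<forall>y\<in>{1..n}. \<exists>g\<in>G. g x = y) \<longrightarrow> transitivity_gap n \<sigma> 1 m = 0) \<and>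
    (transitivity_gap n \<sigma> 1 m = 0 \<and> (subset_density n r m)\<^sup>2 + \<mu>\<^sup>2 \<le> 1 \<longrightarrow>
       eff_mst n G \<sigma> m
         \<le> (1 + (\<Sum>j=1..r. 1 / 2 ^ effective_rows_above n \<sigma> j * (real (c j) / (real (c j) + 1))))
            * (subset_density n 1 m)\<^sup>2 \<and>
       (1 + (\<Sum>j=1..r. 1 / 2 ^ effective_rows_above n \<sigma> j * (real (c j) / (real (c j) + 1))))
            * (subset_density n 1 m)\<^sup>2
         \<le> 3 * (subset_density n 1 m)\<^sup>2)"
proof -
  have n: "1 \<le> n" using assms(1,2) by simp
  have sums: "(\<Sum>j=1..r. 1 / 2 ^ effective_rows_above n \<sigma> j * (real (c j) / (real (c j) + 1)))
      = (\<Sum>j=1..max_effective_row n \<sigma>. 1 / 2 ^ effective_rows_above n \<sigma> j *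
          (real (num_switches n \<sigma> j) / (real (num_switches n \<sigma> j) + 1)))"
    unfolding assms(5)[symmetric] by (intro sum.cong) (simp_all add: assms(6))
  \<comment> \<open>Transitivity gives \<open>c 1 = n - 1\<close>, and \<open>1 \<le> m\<close>
    makes \<open>n < 1 + (n - 1) + m\<close>.\<close>
  have "transitivity_gap n \<sigma> 1 m = 0" if "\<forall>x\<in>{1..n}. \<forall>y\<in>{1..n}. \<exists>g\<in>G. g x = y"
    using num_switches_transitive[OF assms(4) n that] assms(1) n
    by (simp add: transitivity_gap_eq_0_iff)
  \<comment> \<open>The constant 3 is 1 plus the bound 2 for the weights.\<close>
  thus ?thesis
    unfolding sums
    using eff_mst_le[OF assms(1-4)] sum_weights_le_2[of n \<sigma>]
    by (auto intro!: mult_right_mono)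
qed

end
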